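(* Let $\lambda$ be a nonzero real number. For all integers $n,k\ge0$ with $n\ge k$, \[ S_{J,\lambda}^{(2)}(n,k)=\frac{1}{k!}\sum_{l=0}^{k}\binom{k}{l}(-1)^{k-l}B_{n,\lambda}(l). \]
   Context: For a nonzero real $\lambda$, set $(x)_{0,\lambda}=1$ and $(x)_{n,\lambda}=x(x-\lambda)\cdots(x-(n-1)\lambda)$ for $n\ge1$. Let $e_\lambda^x(t)=\sum_{n\ge0}(x)_{n,\lambda}\frac{t^n}{n!}=(1+\lambda t)^{x/\lambda}$ and $e_\lambda(t)=e_\lambda^1(t)$. The degenerate Bell polynomials are defined by $e_\lambda^x(e_\lambda(t)-1)=\sum_{n\ge0}B_{n,\lambda}(x)\frac{t^n}{n!}$. The Jindalrae-Stirling numbers of the second kind are defined by $\frac{1}{k!}\big(e_\lambda(e_\lambda(t)-1)-1\big)^k=\sum_{n\ge k}S_{J,\lambda}^{(2)}(n,k)\frac{t^n}{n!}$ for $k\ge0$. *)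

theory Defs
  imports "HOL-Computational_Algebra.Computational_Algebra"
begin

text \<open>All generating functions are formal power series in \<open>t\<close> over the reals.\<close>

definition deg_ffact :: "real \<Rightarrow> real \<Rightarrow> nat \<Rightarrow> real" where
  "deg_ffact lam x n = (\<Prod>i<n. x - real i * lam)"

definition deg_exp :: "real \<Rightarrow> real \<Rightarrow> real fps" where
  "deg_exp lam x = Abs_fps (\<lambda>n. deg_ffact lam x n / fact n)"

text \<open>The closed form \<open>(1 + lam t)^(x/lam)\<close> of the degenerate exponential.\<close>

lemma deg_exp_eq_binomial:
  assumes "lam \<noteq> 0"
  shows "deg_exp lam x = fps_compose (fps_binomial (x / lam)) (fps_const lam * fps_X)"
proof (rule fps_ext)
  fix n
  have "(\<Prod>i<n. x - real i * lam) = lam ^ n * (\<Prod>i<n. x / lam - real i)"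
    using assms by (induction n) (simp_all add: field_simps)
  then show "fps_nth (deg_exp lam x) n =
      fps_nth (fps_compose (fps_binomial (x / lam)) (fps_const lam * fps_X)) n"
    by (simp add: deg_exp_def deg_ffact_def fps_compose_linear gbinomial_prod_rev
        atLeast0LessThan)
qed

text \<open>
  The inner series \<open>deg_exp lam 1 - 1\<close> has zero constant term, so the compositions
  below are the genuine substitutions of power series.
\<close>

lemma deg_exp_minus_1_nth_0: "fps_nth (deg_exp lam x - 1) 0 = 0"
  by (simp add: deg_exp_def deg_ffact_def)

definition deg_bell :: "real \<Rightarrow> nat \<Rightarrow> real \<Rightarrow> real" where
  "deg_bell lam n x =
     fact n * fps_nth (fps_compose (deg_exp lam x) (deg_exp lam 1 - 1)) n"

lemma deg_bell_gf:
  "Abs_fps (\<lambda>n. deg_bell lam n x / fact n) =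
     fps_compose (deg_exp lam x) (deg_exp lam 1 - 1)"
  by (rule fps_ext) (simp add: deg_bell_def)

definition jindalrae_stirling2 :: "real \<Rightarrow> nat \<Rightarrow> nat \<Rightarrow> real" where
  "jindalrae_stirling2 lam n k =
     fact n * fps_nth (fps_const (1 / fact k) *
       (fps_compose (deg_exp lam 1) (deg_exp lam 1 - 1) - 1) ^ k) n"

text \<open>
  The defining generating function sums over \<open>n \<ge> k\<close> only; the coefficients with
  \<open>n < k\<close> vanish.
\<close>

lemma jindalrae_stirling2_eq_0:
  assumes "n < k"
  shows "jindalrae_stirling2 lam n k = 0"
proof -
  have "fps_nth (fps_compose (deg_exp lam 1) (deg_exp lam 1 - 1) - 1) 0 = 0"
    by (simp add: deg_exp_def deg_ffact_def)
  then show ?thesis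
    using assms by (simp add: jindalrae_stirling2_def startsby_zero_power_prefix)
qed

lemma jindalrae_stirling2_gf:
  "Abs_fps (\<lambda>n. if n \<ge> k then jindalrae_stirling2 lam n k / fact n else 0) =
     fps_const (1 / fact k) *
       (fps_compose (deg_exp lam 1) (deg_exp lam 1 - 1) - 1) ^ k"
proof -
  have "(if n \<ge> k then jindalrae_stirling2 lam n k / fact n else 0) =
      jindalrae_stirling2 lam n k / fact n" for n
    using jindalrae_stirling2_eq_0[of n k lam] by auto
  then show ?thesis
    by (intro fps_ext) (simp add: jindalrae_stirling2_def)
qed

end

theory Submission
  imports Defs
begin

text \<open>Degenerate exponentials turn sums of exponents into products, so the one at
  \<open>real l\<close> is the \<open>l\<close>-th power of the one at 1
  (\<open>deg_exp_of_nat\<close>). Substituting a series with zero constant term respects powers;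
  hence the Bell generating function at \<open>l\<close> is \<open>G ^ l\<close>, with
  \<open>G\<close> the one at 1. The claim is the n-th coefficient of the binomial expansion of
  \<open>(G - 1) ^ k\<close>.\<close>

text \<open>Exponents add in the closed form (1 + lam t)^(x/lam), and substitution is
  multiplicative.\<close>

lemma deg_exp_add:
  assumes "lam \<noteq> 0"
  shows "deg_exp lam (x + y) = deg_exp lam x * deg_exp lam y"
  using assms
  by (simp add: deg_exp_eq_binomial add_divide_distrib fps_binomial_add_mult
      fps_compose_mult_distrib)

lemma deg_exp_0: "deg_exp lam 0 = 1"
  by (rule fps_ext) (auto simp: deg_exp_def deg_ffact_def prod_zero_iff)

lemma deg_exp_of_nat:
  assumes "lam \<noteq> 0"
  shows "deg_exp lam (real l) = deg_exp lam 1 ^ l"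
proof (induction l)
  case 0
  then show ?case by (simp add: deg_exp_0)
next
  case (Suc l)
  then show ?case
    using deg_exp_add[OF assms, of 1 "real l"] by simp
qed

theorem theorem6:
  fixes lam :: real and n k :: nat
  assumes "lam \<noteq> 0" and "n \<ge> k"
  shows "jindalrae_stirling2 lam n k =
    1 / fact k * (\<Sum>l = 0..k. real (k choose l) * (-1) ^ (k - l) * deg_bell lam n (real l))"
proof -
  define G where "G = fps_compose (deg_exp lam 1) (deg_exp lam 1 - 1)"
  have bell: "deg_bell lam n (real l) = fact n * fps_nth (G ^ l) n" for l
    unfolding deg_bell_def G_def deg_exp_of_nat[OF assms(1)]
    by (simp only: fps_compose_power[OF deg_exp_minus_1_nth_0])
  \<comment> \<open>As constant series, the scalars can be pulled out of
    \<open>fps_nth\<close>.\<close>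
  have const: "of_nat (k choose l) * (-1) ^ (k - l) =
      fps_const (real (k choose l) * (-1) ^ (k - l))" for l
    by (simp flip: fps_of_nat fps_const_power fps_const_neg fps_const_1_eq_1 fps_const_mult)
  have "(G - 1) ^ k = (\<Sum>l\<le>k. of_nat (k choose l) * G ^ l * (-1) ^ (k - l))"
    using binomial_ring[of G "-1" k] by simp
  also have "\<dots> = (\<Sum>l = 0..k. fps_const (real (k choose l) * (-1) ^ (k - l)) * G ^ l)"
    unfolding const[symmetric] by (simp add: atLeast0AtMost mult_ac)
  finally have "fps_nth ((G - 1) ^ k) n =
      (\<Sum>l = 0..k. real (k choose l) * (-1) ^ (k - l) * fps_nth (G ^ l) n)"
    by (simp add: fps_sum_nth)
  then show ?thesis
    by (simp add: jindalrae_stirling2_def bell sum_distrib_left mult_ac flip: G_def)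
qed

end
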